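(* Let $\mathscr{H}$ be a complex Hilbert space, $S\in\mathscr{B}(\mathscr{H})$, $0\le\alpha\le1$ and $r\ge1$. Then $$dw^{2r}(S)\le2^{r-1}\left\|\alpha|S|^{2r}+(1-\alpha)|S^*|^{2r}+|S^*S|^{2r}\right\|.$$
   Context: $\mathscr{B}(\mathscr{H})$ is the algebra of bounded linear operators on the complex Hilbert space $\mathscr{H}$, $\|\cdot\|$ is the operator norm, $|A|=(A^*A)^{1/2}$, and real powers of positive operators are defined by functional calculus. The Davis--Wielandt radius of $S$ is $dw(S)=\sup_{\|x\|=1}\sqrt{|\langle Sx,x\rangle|^2+\|Sx\|^4}$, the supremum being over unit vectors $x\in\mathscr{H}$; $dw^{2r}(S)$ means $(dw(S))^{2r}$. *)

theory Defs
  imports "HOL-Analysis.Analysis" "HOL-Computational_Algebra.Polynomial"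
begin

(* The norm, metric and completeness are those of the library class banach, so the
   axiom cinner_self says that the Banach norm is the one induced by the inner product;
   it subsumes positivity and definiteness.  The inner product is linear in its first
   argument.  The zero space is allowed. *)
class complex_hilbert = banach +
  fixes scaleC :: "complex \<Rightarrow> 'a \<Rightarrow> 'a"  (infixr "*\<^sub>C" 75)
    and cinner :: "'a \<Rightarrow> 'a \<Rightarrow> complex"
  assumes scaleC_add_right: "c *\<^sub>C (x + y) = c *\<^sub>C x + c *\<^sub>C y"
    and scaleC_add_left: "(c + d) *\<^sub>C x = c *\<^sub>C x + d *\<^sub>C x"
    and scaleC_scaleC: "c *\<^sub>C (d *\<^sub>C x) = (c * d) *\<^sub>C x"
    and scaleC_of_real: "complex_of_real a *\<^sub>C x = a *\<^sub>R x"
    and cinner_commute: "cinner x y = cnj (cinner y x)"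
    and cinner_add_left: "cinner (x + y) z = cinner x z + cinner y z"
    and cinner_scaleC_left: "cinner (c *\<^sub>C x) y = c * cinner x y"
    and cinner_self: "cinner x x = complex_of_real ((norm x)\<^sup>2)"

instantiation complex :: complex_hilbert
begin

definition scaleC_complex :: "complex \<Rightarrow> complex \<Rightarrow> complex"
  where "scaleC_complex c x = c * x"

definition cinner_complex :: "complex \<Rightarrow> complex \<Rightarrow> complex"
  where "cinner_complex x y = x * cnj y"

instance
proof
  fix c d x y z :: complex and a :: real
  show "c *\<^sub>C (x + y) = c *\<^sub>C x + c *\<^sub>C y"
    by (simp add: scaleC_complex_def distrib_left)
  show "(c + d) *\<^sub>C x = c *\<^sub>C x + d *\<^sub>C x"
    by (simp add: scaleC_complex_def distrib_right)
  show "c *\<^sub>C (d *\<^sub>C x) = (c * d) *\<^sub>C x"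
    by (simp add: scaleC_complex_def)
  show "complex_of_real a *\<^sub>C x = a *\<^sub>R x"
    by (simp add: scaleC_complex_def scaleR_conv_of_real)
  show "cinner x y = cnj (cinner y x)"
    by (simp add: cinner_complex_def)
  show "cinner (x + y) z = cinner x z + cinner y z"
    by (simp add: cinner_complex_def distrib_right)
  show "cinner (c *\<^sub>C x) y = c * cinner x y"
    by (simp add: scaleC_complex_def cinner_complex_def)
  show "cinner x x = complex_of_real ((norm x)\<^sup>2)"
    unfolding cinner_complex_def by (rule complex_norm_square [symmetric])
qed

end

(* The library type of bounded operators only imposes real linearity; its norm is the
   operator norm. *)
definition bounded_operators :: "('a::complex_hilbert \<Rightarrow>\<^sub>L 'a) set"
  where "bounded_operators = {S :: 'a \<Rightarrow>\<^sub>L 'a. \<forall>c x. S (c *\<^sub>C x) = c *\<^sub>C S x}"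

(* The library constant adjoint refers to a real inner product. *)
definition cadjoint :: "('a::complex_hilbert \<Rightarrow>\<^sub>L 'a) \<Rightarrow> 'a \<Rightarrow>\<^sub>L 'a"
  where "cadjoint S = (THE T :: 'a \<Rightarrow>\<^sub>L 'a. T \<in> bounded_operators \<and>
    (\<forall>x y. cinner (S x) y = cinner x (T y)))"

definition op_spectrum :: "('a::complex_hilbert \<Rightarrow>\<^sub>L 'a) \<Rightarrow> complex set"
  where "op_spectrum A = {z. \<not> (\<exists>B :: 'a \<Rightarrow>\<^sub>L 'a. B \<in> bounded_operators \<and>
    (\<forall>x. B (A x - z *\<^sub>C x) = x \<and> A (B x) - z *\<^sub>C B x = x))}"

definition op_poly :: "real poly \<Rightarrow> ('a::complex_hilbert \<Rightarrow>\<^sub>L 'a) \<Rightarrow> 'a \<Rightarrow>\<^sub>L 'a"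
  where "op_poly p A = (\<Sum>i\<le>degree p. coeff p i *\<^sub>R (((o\<^sub>L) A) ^^ i) id_blinfun)"

(* Continuous functional calculus f(A) of a self-adjoint operator A, whose spectrum is
   real, for real-valued f: the limit in operator norm of p\<^sub>n(A) whenever the real
   polynomials p\<^sub>n converge to f uniformly on the spectrum.  Meaningful only for A
   self-adjoint and f continuous on the spectrum. *)
definition functional_calculus ::
    "(real \<Rightarrow> real) \<Rightarrow> ('a::complex_hilbert \<Rightarrow>\<^sub>L 'a) \<Rightarrow> 'a \<Rightarrow>\<^sub>L 'a"
  where "functional_calculus f A = (THE B. \<forall>p :: nat \<Rightarrow> real poly.
    uniform_limit {t. complex_of_real t \<in> op_spectrum A} (\<lambda>n. poly (p n)) f sequentially
      \<longrightarrow> (\<lambda>n. op_poly (p n) A) \<longlonglongrightarrow> B)"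

(* Intended for positive A and s > 0 (in the library 0 powr 0 = 0). *)
definition op_powr :: "('a::complex_hilbert \<Rightarrow>\<^sub>L 'a) \<Rightarrow> real \<Rightarrow> 'a \<Rightarrow>\<^sub>L 'a"
  where "op_powr A s = functional_calculus (\<lambda>t. t powr s) A"

definition op_abs :: "('a::complex_hilbert \<Rightarrow>\<^sub>L 'a) \<Rightarrow> 'a \<Rightarrow>\<^sub>L 'a"
  where "op_abs A = op_powr (cadjoint A o\<^sub>L A) (1 / 2)"

(* On the zero space there are no unit vectors; the supremum of the empty set of
   nonnegative reals is then 0, whereas the library leaves Sup {} unspecified on real. *)
definition dw :: "('a::complex_hilbert \<Rightarrow>\<^sub>L 'a) \<Rightarrow> real"
  where "dw S = (if (UNIV :: 'a set) = {0} then 0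
    else (SUP x\<in>{x. norm x = 1}. sqrt ((cmod (cinner (S x) x))\<^sup>2 + norm (S x) ^ 4)))"

end

(* For a unit vector x, |<Sx,x>| is at most both |Sx| and |S*x|, so by convexity of u^r, |<Sx,x>|^(2r)
   is at most alpha |Sx|^(2r) + (1 - alpha) |S*x|^(2r); moreover |Sx|^2 = <S*Sx,x> <= |S*Sx|.
   McCarthy's inequality |Tx|^(2r) <= <|T|^(2r) x,x> for T = S, S*, S*S and the inequality
   (u + v)^r <= 2^(r-1) (u^r + v^r) then give the bound.
   The functional calculus rests on one fact: a real polynomial p nonnegative on the real spectrum of
   a self-adjoint A satisfies p(A) >= 0.  Indeed the infimum m of the numerical range of p(A) is an
   approximate eigenvalue, so factoring p - m into complex linear factors, one of its roots must lie
   in the spectrum of A; that root is real since A - z is bounded below for nonreal z. *)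

theory Submission
  imports Defs "HOL-Computational_Algebra.Fundamental_Theorem_Algebra"
begin

section \<open>Inner products\<close>

lemma cinner_add_right: "cinner x (y + z) = cinner x y + cinner x z"
  by (metis cinner_add_left cinner_commute complex_cnj_add)

lemma cinner_scaleC_right: "cinner x (c *\<^sub>C y) = cnj c * cinner x y"
  by (metis cinner_commute cinner_scaleC_left complex_cnj_mult)

lemma cinner_scaleR_left: "cinner (a *\<^sub>R x) y = of_real a * cinner x y"
  by (metis cinner_scaleC_left scaleC_of_real)

lemma cinner_scaleR_right: "cinner x (a *\<^sub>R y) = of_real a * cinner x y"
  by (metis cinner_scaleC_right scaleC_of_real complex_cnj_complex_of_real)

lemma cinner_zero_left [simp]: "cinner 0 x = 0"
  using cinner_scaleR_left[of 0 0 x] by simp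

lemma cinner_zero_right [simp]: "cinner x 0 = 0"
  using cinner_scaleR_right[of x 0 0] by simp

lemma cinner_minus_left: "cinner (- x) y = - cinner x y"
  using cinner_scaleR_left[of "-1" x y] by simp

lemma cinner_minus_right: "cinner x (- y) = - cinner x y"
  using cinner_scaleR_right[of x "-1" y] by simp

lemma cinner_diff_left: "cinner (x - y) z = cinner x z - cinner y z"
  by (metis cinner_add_left cinner_minus_left diff_conv_add_uminus)

lemma cinner_diff_right: "cinner x (y - z) = cinner x y - cinner x z"
  by (metis cinner_add_right cinner_minus_right diff_conv_add_uminus)

lemmas cinner_simps = cinner_add_left cinner_add_right cinner_diff_left cinner_diff_right
  cinner_minus_left cinner_minus_right cinner_scaleR_left cinner_scaleR_right
  cinner_scaleC_left cinner_scaleC_right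

lemma Re_cinner_commute: "Re (cinner x y) = Re (cinner y x)"
  by (metis cinner_commute complex_cnj cnj.simps(1))

lemma Re_cinner_self: "Re (cinner x x) = (norm x)\<^sup>2"
  by (simp add: cinner_self)

lemma scaleC_zero_left [simp]: "0 *\<^sub>C x = 0"
  using scaleC_of_real[of 0 x] by simp

lemma scaleC_zero_right [simp]: "c *\<^sub>C 0 = 0"
  using scaleC_add_right[of c 0 0] by simp

lemma scaleC_minus_left: "(- c) *\<^sub>C x = - (c *\<^sub>C x)"
  using scaleC_add_left[of c "- c" x] by (simp add: eq_neg_iff_add_eq_0 add.commute)

lemma scaleC_minus_right: "c *\<^sub>C (- x) = - (c *\<^sub>C x)"
  using scaleC_add_right[of c x "- x"] by (simp add: eq_neg_iff_add_eq_0 add.commute)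

lemma scaleC_diff_right: "c *\<^sub>C (x - y) = c *\<^sub>C x - c *\<^sub>C y"
  using scaleC_add_right[of c x "- y"] by (simp add: scaleC_minus_right)

lemma scaleC_scaleR: "c *\<^sub>C (a *\<^sub>R x) = a *\<^sub>R (c *\<^sub>C x)"
  by (metis mult.commute scaleC_of_real scaleC_scaleC)

lemma norm_scaleC: "norm (c *\<^sub>C x) = cmod c * norm x"
proof -
  have "complex_of_real ((norm (c *\<^sub>C x))\<^sup>2) = (c * cnj c) * cinner x x"
    by (simp add: cinner_self[symmetric] cinner_simps mult_ac del: of_real_power)
  also have "\<dots> = complex_of_real ((cmod c * norm x)\<^sup>2)"
    by (simp add: cinner_self complex_norm_square[symmetric] power_mult_distrib)
  finally have "(norm (c *\<^sub>C x))\<^sup>2 = (cmod c * norm x)\<^sup>2"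
    using of_real_eq_iff by blast
  then show ?thesis by (simp add: power2_eq_iff_nonneg)
qed

lemma norm_add_square: "(norm (x + y))\<^sup>2 = (norm x)\<^sup>2 + 2 * Re (cinner x y) + (norm y)\<^sup>2"
proof -
  have "(norm (x + y))\<^sup>2 = Re (cinner (x + y) (x + y))" by (simp add: Re_cinner_self)
  also have "\<dots> = (norm x)\<^sup>2 + 2 * Re (cinner x y) + (norm y)\<^sup>2"
    using Re_cinner_commute[of x y] by (simp add: cinner_add_left cinner_add_right Re_cinner_self)
  finally show ?thesis .
qed

text \<open>The norm is that of a Banach space, so the triangle inequality is already at hand;
  squaring it and expanding leaves exactly Cauchy-Schwarz for real parts.\<close>

lemma Re_cinner_le: "Re (cinner x y) \<le> norm x * norm y"
proof -
  have "(norm (x + y))\<^sup>2 \<le> (norm x + norm y)\<^sup>2"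
    by (simp add: norm_triangle_ineq power_mono)
  then show ?thesis by (simp add: norm_add_square power2_sum)
qed

lemma cmod_cinner_le: "cmod (cinner x y) \<le> norm x * norm y"
proof (cases "cinner x y = 0")
  case False
  \<comment> \<open>A unimodular factor that rotates the inner product onto the positive real axis,
    where the bound on real parts applies.\<close>
  define c where "c = cnj (sgn (cinner x y))"
  have "c * cinner x y = cmod (cinner x y)"
    unfolding c_def sgn_eq using False
    by (simp add: complex_norm_square[symmetric] mult.commute[of "cnj _"] power2_eq_square)
  then have "cmod (cinner x y) = Re (cinner (c *\<^sub>C x) y)"
    by (simp add: cinner_scaleC_left)
  also have "\<dots> \<le> norm (c *\<^sub>C x) * norm y" by (rule Re_cinner_le)
  also have "norm (c *\<^sub>C x) = norm x"
    using False by (simp add: norm_scaleC c_def norm_sgn)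
  finally show ?thesis .
qed simp

lemma abs_Re_cinner_le: "\<bar>Re (cinner x y)\<bar> \<le> norm x * norm y"
  using abs_Re_le_cmod cmod_cinner_le order_trans by blast

text \<open>Testing with \<open>y - z\<close> itself produces a squared norm. Because real parts
  suffice, vectors can be identified through real-valued functionals and their limits.\<close>

lemma cinner_ext:
  assumes "\<And>x. Re (cinner x y) = Re (cinner x z)"
  shows "y = z"
proof -
  have "Re (cinner (y - z) (y - z)) = 0"
    using assms[of "y - z"] by (simp add: cinner_diff_right)
  then show ?thesis by (simp add: Re_cinner_self)
qed

lemma Im_cinner_eq: "Im (cinner x y) = Re (cinner x (\<i> *\<^sub>C y))"
  by (simp add: cinner_scaleC_right)

lemma bounded_linear_Re_cinner_left: "bounded_linear (\<lambda>x. Re (cinner x y))"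
  by (rule bounded_linear_intro[where K = "norm y"])
    (use abs_Re_cinner_le[of _ y] in \<open>simp_all add: cinner_simps\<close>)

lemma bounded_bilinear_Re_cinner: "bounded_bilinear (\<lambda>x y. Re (cinner x y))"
proof (rule bounded_bilinear.intro)
  show "\<exists>K. \<forall>a b. norm (Re (cinner a b)) \<le> norm a * norm b * K"
    by (intro exI[of _ 1] allI) (simp add: abs_Re_cinner_le)
qed (simp_all add: cinner_simps)

lemmas tendsto_Re_cinner = bounded_bilinear.tendsto[OF bounded_bilinear_Re_cinner]

section \<open>Coercive operators and adjoints\<close>

text \<open>First-order condition for a minimum. At \<open>t = - a / (e + 1)\<close> the quadratic
  is a negative multiple of \<open>a\<close> squared unless \<open>a = 0\<close>; the
  \<open>+ 1\<close> keeps the denominator positive when \<open>e = 0\<close>.\<close>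

lemma linear_term_vanishes:
  fixes a e :: real
  assumes "\<And>t. 0 \<le> 2 * t * a + t\<^sup>2 * e" and "0 \<le> e"
  shows "a = 0"
proof -
  define t where "t = - a / (e + 1)"
  have "0 \<le> (2 * t * a + t\<^sup>2 * e) * (e + 1)\<^sup>2"
    using assms(1)[of t] by simp
  also have "\<dots> = 2 * (t * (e + 1)) * a * (e + 1) + (t * (e + 1))\<^sup>2 * e"
    by (simp add: algebra_simps power2_eq_square)
  also have "t * (e + 1) = - a" using assms(2) by (simp add: t_def)
  also have "2 * (- a) * a * (e + 1) + (- a)\<^sup>2 * e = - (a\<^sup>2 * (e + 2))"
    by (simp add: algebra_simps power2_eq_square)
  finally have "a\<^sup>2 * (e + 2) \<le> 0" by simp
  then show ?thesis using assms(2) by (simp add: mult_le_0_iff)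
qed

text \<open>The quadratic functional \<open>x \<mapsto> \<langle>Bx, x\<rangle> - 2 f x\<close> attains its minimum at the required \<open>y\<close>.
  Taking \<open>B\<close> to be the identity gives Riesz representation, taking \<open>f\<close> to be an inner product gives
  surjectivity of \<open>B\<close>.\<close>

lemma coercive_representation:
  fixes B :: "'a::complex_hilbert \<Rightarrow>\<^sub>L 'a" and f :: "'a \<Rightarrow> real"
  assumes sym: "\<And>x y. Re (cinner (B x) y) = Re (cinner x (B y))"
    and c: "0 < c" and coercive: "\<And>x. c * (norm x)\<^sup>2 \<le> Re (cinner (B x) x)"
    and f: "bounded_linear f"
  obtains y where "\<And>x. Re (cinner x (B y)) = f x"
proof -
  interpret f: bounded_linear f by fact
  define J where "J x = Re (cinner (B x) x) - 2 * f x" for x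
  have J_shift: "J (y + t *\<^sub>R x) =
      J y + 2 * t * (Re (cinner x (B y)) - f x) + t\<^sup>2 * Re (cinner (B x) x)" for x y t
    using sym[of x y] Re_cinner_commute[of x "B y"]
    by (simp add: J_def f.add f.scaleR blinfun.bilinear_simps cinner_simps power2_eq_square algebra_simps)
  \<comment> \<open>Parallelogram identity: the linear part cancels and a quarter of the quadratic
    form at \<open>x - y\<close> remains. This strong convexity will force minimizing sequences to
    be Cauchy.\<close>
  have J_mid: "c * (norm (x - y))\<^sup>2 / 4 \<le> (J x + J y) / 2 - J ((1/2) *\<^sub>R (x + y))" for x y
  proof -
    have "(J x + J y) / 2 - J ((1/2) *\<^sub>R (x + y)) = Re (cinner (B (x - y)) (x - y)) / 4"
      by (simp add: J_def f.add f.scaleR blinfun.bilinear_simps cinner_simps field_simps)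
    then show ?thesis using coercive[of "x - y"] by simp
  qed
  obtain K where K: "\<And>x. norm (f x) \<le> norm x * K" using f.bounded by blast
  \<comment> \<open>The lower bound comes from completing the square in
    \<open>c * norm x - K\<close>.\<close>
  have J_lower: "- (K\<^sup>2 / c) \<le> J x" for x
  proof -
    have "0 \<le> (c * norm x - K)\<^sup>2" by simp
    then have "- (K\<^sup>2 / c) \<le> c * (norm x)\<^sup>2 - 2 * (norm x * K)"
      using c by (simp add: field_simps power2_eq_square)
    also have "\<dots> \<le> J x"
      using coercive[of x] K[of x] by (simp add: J_def)
    finally show ?thesis .
  qed
  then have bdd: "bdd_below (range J)" by (meson bdd_belowI2)
  define I where "I = Inf (range J)"
  have I_le: "I \<le> J x" for x
    unfolding I_def using bdd by (simp add: cInf_lower)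
  define d where "d n = inverse (real (Suc n))" for n
  have "\<exists>x. J x < I + d n" for n
    using cInf_lessD[of "range J" "I + d n"] by (auto simp: I_def d_def)
  then obtain u where u: "\<And>n. J (u n) < I + d n" by metis
  \<comment> \<open>Both points are nearly minimal while their midpoint has value at least
    \<open>I\<close>, so strong convexity keeps them close.\<close>
  have u_close: "(norm (u m - u n))\<^sup>2 < e\<^sup>2"
    if "e > 0" "d m < c * e\<^sup>2 / 4" "d n < c * e\<^sup>2 / 4" for e m n
  proof -
    have "c * (norm (u m - u n))\<^sup>2 / 4 \<le> (J (u m) + J (u n)) / 2 - I"
      using J_mid[of "u m" "u n"] I_le[of "(1/2) *\<^sub>R (u m + u n)"] by (rule order_trans[OF _ diff_left_mono])
    also have "\<dots> < c * e\<^sup>2 / 4"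
      using u[of m] u[of n] that by (simp add: field_simps)
    finally have "c * (norm (u m - u n))\<^sup>2 / 4 < c * e\<^sup>2 / 4" .
    then show ?thesis using c by (simp add: mult_less_cancel_left)
  qed
  have "Cauchy u"
  proof (rule metric_CauchyI)
    fix e :: real assume e: "e > 0"
    then have "0 < c * e\<^sup>2 / 4" using c by simp
    then obtain N where N: "d N < c * e\<^sup>2 / 4" unfolding d_def using reals_Archimedean by blast
    have small: "d n < c * e\<^sup>2 / 4" if "n \<ge> N" for n
    proof -
      have "d n \<le> d N" using that by (simp add: d_def divide_simps)
      then show ?thesis using N by simp
    qed
    show "\<exists>M. \<forall>m\<ge>M. \<forall>n\<ge>M. dist (u m) (u n) < e"
    proof (intro exI[of _ N] allI impI)
      fix m n assume "m \<ge> N" "n \<ge> N"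
      then have "(norm (u m - u n))\<^sup>2 < e\<^sup>2" using u_close e small by blast
      then show "dist (u m) (u n) < e" using e by (simp add: dist_norm power2_less_imp_less)
    qed
  qed
  then obtain y where y: "u \<longlonglongrightarrow> y" using Cauchy_convergent convergentD by blast
  have "(\<lambda>n. J (u n)) \<longlonglongrightarrow> J y"
    unfolding J_def
    by (intro tendsto_intros tendsto_Re_cinner blinfun.tendsto f.tendsto y)
  moreover have "(\<lambda>n. I + d n) \<longlonglongrightarrow> I + 0"
    unfolding d_def by (intro tendsto_intros LIMSEQ_inverse_real_of_nat)
  ultimately have "J y \<le> I + 0"
    by (rule LIMSEQ_le) (use u less_imp_le in blast)
  then have min: "J y \<le> J x" for x using I_le[of x] by simp
  \<comment> \<open>Vanishing of the first variation of \<open>J\<close> at the minimizer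
    \<open>y\<close> in the direction \<open>x\<close>.\<close>
  have "Re (cinner x (B y)) - f x = 0" for x
  proof (rule linear_term_vanishes)
    show "0 \<le> 2 * t * (Re (cinner x (B y)) - f x) + t\<^sup>2 * Re (cinner (B x) x)" for t
      using min[of "y + t *\<^sub>R x"] by (simp add: J_shift)
    show "0 \<le> Re (cinner (B x) x)"
      using coercive[of x] c by (smt (verit) mult_nonneg_nonneg zero_le_power2)
  qed
  then show ?thesis by (intro that[of y]) simp
qed

section \<open>Adjoints and inverses of coercive operators\<close>

lemma bounded_operatorsD: "S \<in> bounded_operators \<Longrightarrow> S (c *\<^sub>C x) = c *\<^sub>C S x"
  by (simp add: bounded_operators_def)

lemma adjoint_exists:
  assumes "S \<in> bounded_operators"
  obtains T where "T \<in> bounded_operators" "\<And>x y. cinner (S x) y = cinner x (T y)"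
proof -
  have "\<exists>z. \<forall>x. Re (cinner x z) = Re (cinner (S x) y)" for y
  proof -
    have "bounded_linear (\<lambda>x. Re (cinner (S x) y))"
      using bounded_linear_compose[OF bounded_linear_Re_cinner_left blinfun.bounded_linear_right] .
    from coercive_representation[of id_blinfun 1, OF _ _ _ this]
    show ?thesis by (auto simp: Re_cinner_self)
  qed
  then obtain T where T: "\<And>x y. Re (cinner x (T y)) = Re (cinner (S x) y)" by metis
  have cT: "cinner (S x) y = cinner x (T y)" for x y
  proof (rule complex_eqI)
    \<comment> \<open>Multiplying the first argument by \<open>- \<i>\<close> turns the imaginary
      part of an inner product into a real part, which reduces this to \<open>T\<close>.\<close>
    show "Im (cinner (S x) y) = Im (cinner x (T y))"
      using T[of "- (\<i> *\<^sub>C x)" y] assms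
      by (simp add: cinner_simps bounded_operatorsD blinfun.minus_right)
  qed (simp add: T)
  have add: "T (x + y) = T x + T y" for x y
    by (rule cinner_ext) (simp add: T cinner_add_right)
  have scaleC: "T (c *\<^sub>C x) = c *\<^sub>C T x" for c x
    by (rule cinner_ext) (simp add: cT[symmetric] cinner_scaleC_right)
  have bound: "norm (T y) \<le> norm y * norm S" for y
  proof -
    have "norm (T y) * norm (T y) = Re (cinner (S (T y)) y)"
      using T[of "T y" y] by (simp add: Re_cinner_self power2_eq_square)
    also have "\<dots> \<le> norm (S (T y)) * norm y" by (rule Re_cinner_le)
    also have "\<dots> \<le> (norm S * norm (T y)) * norm y"
      by (intro mult_right_mono norm_blinfun) simp
    finally have "norm (T y) * norm (T y) \<le> norm (T y) * (norm y * norm S)"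
      by (simp add: mult_ac)
    then show ?thesis by (cases "T y = 0") auto
  qed
  have "bounded_linear T"
    by (rule bounded_linear_intro[OF add _ bound]) (metis scaleC scaleC_of_real)
  then show ?thesis
    using that[of "Blinfun T"] cT scaleC
    by (simp add: bounded_operators_def bounded_linear_Blinfun_apply)
qed

lemma
  assumes "S \<in> bounded_operators"
  shows cadjoint_in: "cadjoint S \<in> bounded_operators"
    and cinner_cadjoint: "cinner (S x) y = cinner x (cadjoint S y)"
proof -
  let ?P = "\<lambda>T. T \<in> bounded_operators \<and> (\<forall>x y. cinner (S x) y = cinner x (T y))"
  obtain T where T: "?P T" using adjoint_exists[OF assms] by metis
  have "?P (cadjoint S)"
    unfolding cadjoint_def
  proof (rule theI[of ?P, OF T])
    fix T' assume T': "?P T'"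
    show "T' = T"
      by (rule blinfun_eqI, rule cinner_ext) (metis T T')
  qed
  then show "cadjoint S \<in> bounded_operators" "cinner (S x) y = cinner x (cadjoint S y)" by auto
qed

definition selfadjoint_op :: "('a::complex_hilbert \<Rightarrow>\<^sub>L 'a) \<Rightarrow> bool"
  where "selfadjoint_op A \<longleftrightarrow>
    A \<in> bounded_operators \<and> (\<forall>x y. cinner (A x) y = cinner x (A y))"

lemma selfadjoint_opD:
  assumes "selfadjoint_op A"
  shows "A \<in> bounded_operators" "A (c *\<^sub>C x) = c *\<^sub>C A x" "cinner (A x) y = cinner x (A y)"
  using assms by (auto simp: selfadjoint_op_def bounded_operatorsD)

text \<open>By Cauchy-Schwarz the coercivity constant also bounds \<open>A\<close> from below, which
  yields both injectivity and the bound \<open>1 / c\<close> on the inverse; surjectivity is the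
  variational argument.\<close>

lemma coercive_invertible:
  assumes A: "selfadjoint_op A" and c: "0 < c"
    and coercive: "\<And>x. c * (norm x)\<^sup>2 \<le> Re (cinner (A x) x)"
  obtains B where "B \<in> bounded_operators" "\<And>x. B (A x) = x" "\<And>x. A (B x) = x"
proof -
  have below: "c * norm x \<le> norm (A x)" for x
  proof -
    have "c * (norm x)\<^sup>2 \<le> norm (A x) * norm x"
      using coercive[of x] Re_cinner_le[of "A x" x] by simp
    then show ?thesis by (cases "x = 0") (auto simp: power2_eq_square)
  qed
  have "\<exists>y. A y = z" for z
  proof -
    obtain y where "\<And>x. Re (cinner x (A y)) = Re (cinner x z)"
      using coercive_representation[OF _ c coercive bounded_linear_Re_cinner_left, of z]
        selfadjoint_opD(3)[OF A] by metis
    then show ?thesis using cinner_ext by blast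
  qed
  then obtain B where AB: "\<And>z. A (B z) = z" by metis
  have inj: "x = y" if "A x = A y" for x y
    using below[of "x - y"] that c by (simp add: blinfun.diff_right mult_le_0_iff)
  have BA: "B (A x) = x" for x using AB inj by blast
  have add: "B (x + y) = B x + B y" for x y
    by (rule inj) (simp add: AB blinfun.add_right)
  have scaleC: "B (a *\<^sub>C x) = a *\<^sub>C B x" for a x
    by (rule inj) (simp add: AB selfadjoint_opD[OF A])
  have "norm (B x) \<le> norm x * (1 / c)" for x
    using below[of "B x"] c by (simp add: AB field_simps)
  then have "bounded_linear B"
    by (rule bounded_linear_intro[OF add, rotated]) (metis scaleC scaleC_of_real)
  then show ?thesis
    using that[of "Blinfun B"] AB BA scaleC
    by (simp add: bounded_operators_def bounded_linear_Blinfun_apply)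
qed


section \<open>Real polynomials of a self-adjoint operator\<close>

text \<open>Horner form of the power sum, so that polynomial identities follow by induction over
  \<open>pCons\<close>.\<close>

lemma op_poly_pCons_apply: "op_poly (pCons a p) A x = a *\<^sub>R x + A (op_poly p A x)"
proof (cases "pCons a p = 0")
  case True
  then show ?thesis by (simp add: op_poly_def blinfun.bilinear_simps)
next
  case False
  \<comment> \<open>The upper limit is raised to \<open>Suc (degree p)\<close> because a nonzero
    constant, where \<open>p = 0\<close>, has degree 0; the extra coefficient is then zero.\<close>
  have "op_poly (pCons a p) A = (\<Sum>i\<le>Suc (degree p). coeff (pCons a p) i *\<^sub>R (((o\<^sub>L) A) ^^ i) id_blinfun)"
    unfolding op_poly_def by (rule sum.mono_neutral_left) (auto simp: coeff_eq_0 degree_pCons_le)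
  also have "\<dots> = a *\<^sub>R id_blinfun
      + (\<Sum>i\<le>degree p. coeff p i *\<^sub>R (A o\<^sub>L (((o\<^sub>L) A) ^^ i) id_blinfun))"
    by (simp only: sum.atMost_Suc_shift) simp
  finally show ?thesis
    by (simp add: op_poly_def blinfun.bilinear_simps blinfun.sum_left blinfun.sum_right)
qed

lemma op_poly_0 [simp]: "op_poly 0 A = 0"
  by (simp add: op_poly_def)

lemma op_poly_const_apply: "op_poly [:a:] A x = a *\<^sub>R x"
  by (simp add: op_poly_pCons_apply blinfun.bilinear_simps)

lemma op_poly_add: "op_poly (p + q) A = op_poly p A + op_poly q A"
proof (rule blinfun_eqI)
  show "op_poly (p + q) A x = (op_poly p A + op_poly q A) x" for x
    by (induction p q rule: poly_induct2)
      (simp_all add: op_poly_pCons_apply blinfun.bilinear_simps scaleR_add_left)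
qed

lemma op_poly_smult: "op_poly (smult a p) A = a *\<^sub>R op_poly p A"
proof (rule blinfun_eqI)
  show "op_poly (smult a p) A x = (a *\<^sub>R op_poly p A) x" for x
    by (induction p) (simp_all add: op_poly_pCons_apply blinfun.bilinear_simps scaleR_add_right)
qed

lemma op_poly_diff: "op_poly (p - q) A = op_poly p A - op_poly q A"
  using op_poly_add[of p "- q" A] op_poly_smult[of "-1" q A] by simp

lemma op_poly_mult_apply: "op_poly (p * q) A x = op_poly p A (op_poly q A x)"
  by (induction p)
    (simp_all add: op_poly_pCons_apply op_poly_add op_poly_smult blinfun.bilinear_simps)

lemma op_poly_commute: "op_poly p A (A x) = A (op_poly p A x)"
  by (induction p) (simp_all add: op_poly_pCons_apply blinfun.bilinear_simps)

lemma selfadjoint_op_poly: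
  assumes "selfadjoint_op A"
  shows "selfadjoint_op (op_poly p A)"
proof -
  have "op_poly p A (c *\<^sub>C x) = c *\<^sub>C op_poly p A x" for c x
    by (induction p)
      (simp_all add: op_poly_pCons_apply scaleC_add_right scaleC_scaleR selfadjoint_opD[OF assms])
  moreover have "cinner (op_poly p A x) y = cinner x (op_poly p A y)" for x y
    by (induction p arbitrary: x y)
      (simp_all add: op_poly_pCons_apply cinner_simps selfadjoint_opD(3)[OF assms] op_poly_commute)
  ultimately show ?thesis by (simp add: selfadjoint_op_def bounded_operators_def)
qed

text \<open>Complex polynomials of an operator are only needed pointwise, to split real polynomials into
  linear factors.\<close>

definition cpoly_action :: "('a::complex_hilbert \<Rightarrow>\<^sub>L 'a) \<Rightarrow> complex poly \<Rightarrow> 'a \<Rightarrow> 'a"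
  where "cpoly_action A q = fold_coeffs (\<lambda>a g x. a *\<^sub>C x + A (g x)) q (\<lambda>_. 0)"

lemma cpoly_action_0 [simp]: "cpoly_action A 0 x = 0"
  by (simp add: cpoly_action_def)

lemma cpoly_action_pCons: "cpoly_action A (pCons a q) x = a *\<^sub>C x + A (cpoly_action A q x)"
  by (cases "a = 0 \<and> q = 0") (auto simp: cpoly_action_def)

lemma cpoly_action_add: "cpoly_action A (p + q) x = cpoly_action A p x + cpoly_action A q x"
  by (induction p q rule: poly_induct2)
    (simp_all add: cpoly_action_pCons blinfun.bilinear_simps scaleC_add_left)

lemma cpoly_action_smult:
  assumes "A \<in> bounded_operators"
  shows "cpoly_action A (smult a q) x = a *\<^sub>C cpoly_action A q x"
  by (induction q)
    (simp_all add: cpoly_action_pCons scaleC_add_right scaleC_scaleC bounded_operatorsD[OF assms])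

lemma cpoly_action_linear_factor:
  assumes "A \<in> bounded_operators"
  shows "cpoly_action A ([:- a, 1:] * q) x = A (cpoly_action A q x) - a *\<^sub>C cpoly_action A q x"
proof -
  have "[:- a, 1:] * q = pCons 0 q + smult (- a) q" by simp
  then show ?thesis
    by (simp only: cpoly_action_add cpoly_action_smult[OF assms] cpoly_action_pCons) (simp add: scaleC_minus_left)
qed

lemma cpoly_action_of_real: "cpoly_action A (map_poly of_real p) x = op_poly p A x"
  by (induction p) (simp_all add: map_poly_pCons cpoly_action_pCons op_poly_pCons_apply scaleC_of_real)

section \<open>Spectrum and lower bounds for polynomials of an operator\<close>

definition real_spectrum :: "('a::complex_hilbert \<Rightarrow>\<^sub>L 'a) \<Rightarrow> real set"
  where "real_spectrum A = {t. complex_of_real t \<in> op_spectrum A}"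

lemma poly_map_poly_of_real: "poly (map_poly of_real p) (complex_of_real t) = of_real (poly p t)"
  by (induction p) (simp_all add: map_poly_pCons)

lemma not_in_real_spectrum:
  assumes "t \<notin> real_spectrum A"
  obtains B where "B \<in> bounded_operators" "\<And>x. B (A x - t *\<^sub>R x) = x"
  using assms by (auto simp: real_spectrum_def op_spectrum_def scaleC_of_real)

text \<open>For real \<open>z\<close> the bounded inverse gives the bound. For nonreal
  \<open>z\<close> the number \<open>cinner (A x) x\<close> is real, so the imaginary part of
  \<open>cinner (A x - z *\<^sub>C x) x\<close> has modulus
  \<open>\<bar>Im z\<bar> * (norm x)\<^sup>2\<close>.\<close>

lemma resolvent_bounded_below:
  fixes A :: "'a::complex_hilbert \<Rightarrow>\<^sub>L 'a"
  assumes A: "selfadjoint_op A" and z: "\<And>t. t \<in> real_spectrum A \<Longrightarrow> z \<noteq> complex_of_real t"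
  obtains c where "c > 0" "\<And>x. c * norm x \<le> norm (A x - z *\<^sub>C x)"
proof (cases "Im z = 0")
  case True
  then obtain t where t: "z = complex_of_real t" by (metis complex_is_Real_iff Reals_cases)
  then have "t \<notin> real_spectrum A" using z by blast
  then obtain B :: "'a \<Rightarrow>\<^sub>L 'a" where B: "\<And>x. B (A x - t *\<^sub>R x) = x" by (rule not_in_real_spectrum) blast
  show ?thesis
  proof (rule that)
    \<comment> \<open>The \<open>+ 1\<close> keeps the denominator positive even if \<open>B\<close>
      vanishes, as on the zero space.\<close>
    show "0 < 1 / (norm B + 1)" by (simp add: add_nonneg_pos)
    fix x
    have "norm x \<le> norm B * norm (A x - t *\<^sub>R x)" using norm_blinfun[of B] B by metis
    also have "\<dots> \<le> (norm B + 1) * norm (A x - t *\<^sub>R x)" by (simp add: mult_right_mono)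
    finally show "1 / (norm B + 1) * norm x \<le> norm (A x - z *\<^sub>C x)"
      by (simp add: t scaleC_of_real pos_divide_le_eq add_nonneg_pos mult.commute)
  qed
next
  case False
  show ?thesis
  proof (rule that)
    show "0 < \<bar>Im z\<bar>" using False by simp
    fix x
    have "Im (cinner (A x) x) = 0"
      by (metis A add_cancel_right_right cinner_commute cnj.simps(2) mult_2 neg_equal_zero selfadjoint_opD(3))
    then have "Im (cinner (A x - z *\<^sub>C x) x) = - (Im z * (norm x)\<^sup>2)"
      by (simp add: cinner_simps cinner_self del: of_real_power)
    then have "\<bar>Im z\<bar> * (norm x)\<^sup>2 \<le> cmod (cinner (A x - z *\<^sub>C x) x)"
      by (metis abs_Im_le_cmod abs_minus_cancel abs_mult abs_power2)
    also have "\<dots> \<le> norm (A x - z *\<^sub>C x) * norm x" by (rule cmod_cinner_le)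
    finally show "\<bar>Im z\<bar> * norm x \<le> norm (A x - z *\<^sub>C x)"
      by (cases "x = 0") (auto simp: power2_eq_square)
  qed
qed

text \<open>Induction on the degree: a complex root is split off, it avoids the real spectrum by
  assumption, and the lower bounds of the linear factor and of the quotient multiply.\<close>

lemma cpoly_action_bounded_below:
  assumes A: "selfadjoint_op A" and "q \<noteq> 0"
    and "\<And>t. t \<in> real_spectrum A \<Longrightarrow> poly q (complex_of_real t) \<noteq> 0"
  shows "\<exists>c>0. \<forall>x. c * norm x \<le> norm (cpoly_action A q x)"
  using assms(2,3)
proof (induction "degree q" arbitrary: q)
  case 0
  then obtain a where "q = [:a:]" "a \<noteq> 0" by (metis degree_eq_zeroE pCons_0_0)
  then show ?case
    by (intro exI[of _ "cmod a"]) (simp add: cpoly_action_pCons norm_scaleC blinfun.bilinear_simps)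
next
  case (Suc n)
  have "\<not> constant (poly q)" using Suc.hyps(2) by (simp add: constant_degree)
  then obtain z where "poly q z = 0" using fundamental_theorem_of_algebra by blast
  then obtain p where q: "q = [:- z, 1:] * p" by (auto simp: poly_eq_0_iff_dvd elim: dvdE)
  have "p \<noteq> 0" using Suc.prems(1) q by auto
  have "degree q = Suc (degree p)" using \<open>p \<noteq> 0\<close> unfolding q by (subst degree_mult_eq) auto
  moreover have "poly p (complex_of_real t) \<noteq> 0" if "t \<in> real_spectrum A" for t
    using Suc.prems(2)[OF that] by (auto simp: q)
  ultimately obtain c where c: "c > 0" "\<And>x. c * norm x \<le> norm (cpoly_action A p x)"
    using Suc.hyps \<open>p \<noteq> 0\<close> by (metis Suc_inject)
  have "z \<noteq> complex_of_real t" if "t \<in> real_spectrum A" for t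
    using Suc.prems(2)[OF that] by (auto simp: q)
  then obtain d where d: "d > 0" "\<And>x. d * norm x \<le> norm (A x - z *\<^sub>C x)"
    using resolvent_bounded_below[OF A] by metis
  show ?case
  proof (intro exI[of _ "d * c"] conjI allI)
    fix x
    have "d * c * norm x \<le> d * norm (cpoly_action A p x)"
      using c(2)[of x] d(1) by simp
    also have "\<dots> \<le> norm (cpoly_action A q x)"
      unfolding q cpoly_action_linear_factor[OF selfadjoint_opD(1)[OF A]] by (rule d(2))
    finally show "d * c * norm x \<le> norm (cpoly_action A q x)" .
  qed (use c d in simp)
qed

section \<open>Numerical range and positivity of polynomials of an operator\<close>

definition numerical_inf :: "('a::complex_hilbert \<Rightarrow>\<^sub>L 'a) \<Rightarrow> real"
  where "numerical_inf B = (INF x\<in>{x. norm x = 1}. Re (cinner (B x) x))"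

lemma numerical_inf_le: "numerical_inf B * (norm x)\<^sup>2 \<le> Re (cinner (B x) x)"
proof (cases "x = 0")
  case False
  define y where "y = (1 / norm x) *\<^sub>R x"
  have "- norm B \<le> Re (cinner (B z) z)" if "norm z = 1" for z
    using abs_Re_cinner_le[of "B z" z] norm_blinfun[of B z] that by simp
  then have "bdd_below ((\<lambda>x. Re (cinner (B x) x)) ` {x. norm x = 1})"
    by (intro bdd_belowI2[of _ "- norm B"]) simp
  then have "numerical_inf B \<le> Re (cinner (B y) y)"
    unfolding numerical_inf_def by (rule cINF_lower) (use False in \<open>simp add: y_def\<close>)
  also have "\<dots> = Re (cinner (B x) x) / (norm x)\<^sup>2"
    by (simp add: y_def blinfun.bilinear_simps cinner_simps power2_eq_square)
  finally show ?thesis using False by (simp add: field_simps)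
qed simp

text \<open>The shifted operator \<open>D\<close> is positive, hence its squared norm at
  \<open>x\<close> is at most a constant times its quadratic form. If \<open>D\<close> were bounded
  below, that form would stay away from 0 on unit vectors, so the infimum could be raised.\<close>

lemma numerical_inf_approx_eigenvalue:
  fixes B :: "'a::complex_hilbert \<Rightarrow>\<^sub>L 'a"
  assumes sym: "\<And>x y. cinner (B x) y = cinner x (B y)"
    and "(UNIV :: 'a set) \<noteq> {0}" and "c > 0"
  obtains x where "norm (B x - numerical_inf B *\<^sub>R x) < c * norm x"
proof (rule ccontr)
  assume "\<not> thesis"
  define m where "m = numerical_inf B"
  define D where "D = B - m *\<^sub>R id_blinfun"
  have D: "D x = B x - m *\<^sub>R x" for x by (simp add: D_def blinfun.bilinear_simps)
  have below: "c * norm x \<le> norm (D x)" for x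
    using that[of x] \<open>\<not> thesis\<close> unfolding D m_def by linarith
  define K where "K = norm D + 1"
  have K: "K > 0" by (simp add: K_def add_nonneg_pos)
  have D_pos: "0 \<le> Re (cinner (D x) x)" for x
    using numerical_inf_le[of B x] by (simp add: D cinner_simps cinner_self m_def del: of_real_power)
  \<comment> \<open>Positivity of \<open>D\<close> is applied to
    \<open>x - (1/K) *\<^sub>R D x\<close>; this replaces Cauchy-Schwarz for the form induced by
    \<open>D\<close>.\<close>
  have D_norm: "(norm (D x))\<^sup>2 \<le> K * Re (cinner (D x) x)" for x
  proof -
    define y where "y = D x"
    have "cinner (D y) x = cinner y y"
      unfolding y_def by (simp add: D cinner_simps sym)
    then have eq: "Re (cinner (D (x - (1/K) *\<^sub>R y)) (x - (1/K) *\<^sub>R y)) =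
        Re (cinner (D x) x) - 2 / K * (norm y)\<^sup>2 + (1/K)\<^sup>2 * Re (cinner (D y) y)"
      by (simp add: blinfun.bilinear_simps cinner_simps y_def[symmetric] cinner_self power2_eq_square diff_divide_distrib)
    have "norm (D y) \<le> K * norm y"
      using norm_blinfun[of D y] by (simp add: K_def distrib_right add_increasing2)
    then have "Re (cinner (D y) y) \<le> K * norm y * norm y"
      by (meson Re_cinner_le mult_right_mono norm_ge_zero order_trans)
    then have "(1/K)\<^sup>2 * Re (cinner (D y) y) \<le> (1/K)\<^sup>2 * (K * norm y * norm y)"
      by (rule mult_left_mono) simp
    also have "\<dots> = 1/K * (norm y)\<^sup>2" using K by (simp add: power2_eq_square)
    finally have "0 \<le> Re (cinner (D x) x) - 1/K * (norm y)\<^sup>2"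
      using D_pos[of "x - (1/K) *\<^sub>R y"] unfolding eq by simp
    then show ?thesis using K by (simp add: field_simps y_def)
  qed
  have "m + c\<^sup>2 / K \<le> Re (cinner (B x) x)" if "norm x = 1" for x
  proof -
    have "c\<^sup>2 \<le> (norm (D x))\<^sup>2" using below[of x] that \<open>c > 0\<close> by (simp add: power_mono)
    also have "\<dots> \<le> K * (Re (cinner (B x) x) - m)"
      using D_norm[of x] that by (simp add: D cinner_simps cinner_self)
    finally show ?thesis using K by (simp add: field_simps)
  qed
  \<comment> \<open>The unit sphere must be nonempty for the uniform bound to pass to the infimum;
    on the zero space that infimum is unspecified.\<close>
  moreover obtain x :: 'a where "x \<noteq> 0" using assms(2) by blast
  then have "norm ((1 / norm x) *\<^sub>R x) = 1" by simp
  then have "{x :: 'a. norm x = 1} \<noteq> {}" by blast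
  ultimately have "m + c\<^sup>2 / K \<le> m"
    unfolding m_def numerical_inf_def by (intro cINF_greatest) (auto simp: m_def numerical_inf_def)
  then show False using \<open>c > 0\<close> K by (simp add: divide_le_0_iff)
qed

text \<open>Otherwise \<open>p\<close> minus the infimum has no zero on the real spectrum, and the
  resulting lower bound contradicts the approximate eigenvalue. Positive degree ensures that the
  shifted polynomial is not zero.\<close>

lemma numerical_inf_op_poly:
  fixes A :: "'a::complex_hilbert \<Rightarrow>\<^sub>L 'a"
  assumes A: "selfadjoint_op A" and "degree p > 0" and "(UNIV :: 'a set) \<noteq> {0}"
  obtains t where "t \<in> real_spectrum A" "poly p t = numerical_inf (op_poly p A)"
proof (rule ccontr)
  assume contra: "\<not> thesis"
  let ?m = "numerical_inf (op_poly p A)"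
  define q where "q = p - [:?m:]"
  have "q \<noteq> 0"
  proof
    assume "q = 0"
    then have "p = [:?m:]" by (simp add: q_def)
    then show False using assms(2) by (metis degree_pCons_0 less_irrefl)
  qed
  have "\<exists>c>0. \<forall>x. c * norm x \<le> norm (cpoly_action A (map_poly of_real q) x)"
  proof (rule cpoly_action_bounded_below[OF A])
    show "map_poly of_real q \<noteq> (0 :: complex poly)"
      using \<open>q \<noteq> 0\<close> by (simp add: map_poly_eq_0_iff)
    fix t assume "t \<in> real_spectrum A"
    then have "poly q t \<noteq> 0" using contra that by (auto simp: q_def)
    then show "poly (map_poly of_real q) (complex_of_real t) \<noteq> 0" by (simp add: poly_map_poly_of_real)
  qed
  then obtain c where c: "c > 0" "\<And>x. c * norm x \<le> norm (op_poly p A x - ?m *\<^sub>R x)"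
    by (auto simp: cpoly_action_of_real q_def op_poly_diff op_poly_const_apply blinfun.bilinear_simps)
  obtain x where "norm (op_poly p A x - ?m *\<^sub>R x) < c * norm x"
    by (rule numerical_inf_approx_eigenvalue[OF selfadjoint_opD(3)[OF selfadjoint_op_poly[OF A]] assms(3) c(1)])
  then show False using c(2)[of x] by simp
qed

lemma op_poly_nonneg:
  fixes A :: "'a::complex_hilbert \<Rightarrow>\<^sub>L 'a"
  assumes A: "selfadjoint_op A" and p: "\<And>t. t \<in> real_spectrum A \<Longrightarrow> 0 \<le> poly p t"
  shows "0 \<le> Re (cinner (op_poly p A x) x)"
proof (cases "x = 0")
  case False
  then have nontrivial: "(UNIV :: 'a set) \<noteq> {0}" by blast
  show ?thesis
  proof (cases "degree p > 0")
    case True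
    then have "0 \<le> numerical_inf (op_poly p A)"
      using p numerical_inf_op_poly[OF A True nontrivial] by metis
    then show ?thesis using numerical_inf_le[of "op_poly p A" x]
      by (smt (verit) mult_nonneg_nonneg zero_le_power2)
  next
    case False
    then obtain a where a: "p = [:a:]" by (metis degree_eq_zeroE not_gr_zero)
    \<comment> \<open>A constant says nothing about its sign unless the spectrum is nonempty; the
      identity polynomial supplies a spectral point.\<close>
    obtain t where "t \<in> real_spectrum A"
      by (rule numerical_inf_op_poly[OF A _ nontrivial, of "[:0, 1:]"]) auto
    then have "0 \<le> a" using p a by fastforce
    then show ?thesis by (simp add: a op_poly_const_apply cinner_simps cinner_self del: of_real_power)
  qed
qed simp

text \<open>Positivity of \<open>[:e\<^sup>2:] - p * p\<close> on the spectrum, with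
  self-adjointness turning the square of \<open>p(A)\<close> into a squared norm. This continuity
  estimate is what makes the calculus converge.\<close>

lemma norm_op_poly_le:
  assumes A: "selfadjoint_op A" and "0 \<le> e"
    and p: "\<And>t. t \<in> real_spectrum A \<Longrightarrow> \<bar>poly p t\<bar> \<le> e"
  shows "norm (op_poly p A) \<le> e"
proof (rule norm_blinfun_bound)
  fix x
  have "0 \<le> Re (cinner (op_poly ([:e\<^sup>2:] - p * p) A x) x)"
  proof (rule op_poly_nonneg[OF A])
    fix t assume "t \<in> real_spectrum A"
    then have "\<bar>poly p t\<bar>\<^sup>2 \<le> e\<^sup>2" by (intro power_mono p) auto
    then show "0 \<le> poly ([:e\<^sup>2:] - p * p) t" by (simp add: power2_eq_square)
  qed
  also have "\<dots> = e\<^sup>2 * Re (cinner x x) - Re (cinner (op_poly p A (op_poly p A x)) x)"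
    by (simp add: op_poly_diff op_poly_const_apply op_poly_mult_apply blinfun.bilinear_simps cinner_simps)
  also have "\<dots> = e\<^sup>2 * (norm x)\<^sup>2 - (norm (op_poly p A x))\<^sup>2"
    using selfadjoint_opD(3)[OF selfadjoint_op_poly[OF A], of p "op_poly p A x" x]
    by (simp only: Re_cinner_self)
  finally have "(norm (op_poly p A x))\<^sup>2 \<le> (e * norm x)\<^sup>2" by (simp add: power_mult_distrib)
  then show "norm (op_poly p A x) \<le> e * norm x"
    by (rule power2_le_imp_le) (use \<open>0 \<le> e\<close> in simp)
qed fact

section \<open>Continuous functional calculus\<close>

text \<open>For \<open>t\<close> outside the interval, \<open>A - t\<close> or its negative is
  coercive and therefore invertible.\<close>

lemma real_spectrum_nonneg:
  fixes A :: "'a::complex_hilbert \<Rightarrow>\<^sub>L 'a"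
  assumes A: "selfadjoint_op A" and nonneg: "\<And>x. 0 \<le> Re (cinner (A x) x)"
  shows "real_spectrum A \<subseteq> {0..norm A}"
proof (rule subsetI, rule ccontr)
  fix t assume t: "t \<in> real_spectrum A" and "t \<notin> {0..norm A}"
  \<comment> \<open>The sign selects the coercive one: \<open>A - t\<close> below 0, and
    \<open>t - A\<close> above the norm.\<close>
  define \<sigma> :: real where "\<sigma> = (if t < 0 then 1 else - 1)"
  define D where "D = \<sigma> *\<^sub>R (A - t *\<^sub>R id_blinfun)"
  have D: "D x = \<sigma> *\<^sub>R (A x - t *\<^sub>R x)" for x by (simp add: D_def blinfun.bilinear_simps)
  have "selfadjoint_op D"
    using selfadjoint_opD[OF A]
    by (auto simp: selfadjoint_op_def bounded_operators_def D cinner_simps scaleC_scaleR scaleC_diff_right)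
  moreover obtain c where "0 < c" "\<And>x. c * (norm x)\<^sup>2 \<le> Re (cinner (D x) x)"
  proof (cases "t < 0")
    case True
    have "- t * (norm x)\<^sup>2 \<le> Re (cinner (D x) x)" for x
      using nonneg[of x] True by (simp add: D \<sigma>_def cinner_simps cinner_self del: of_real_power)
    then show ?thesis using that[of "- t"] True by simp
  next
    case False
    have "(t - norm A) * (norm x)\<^sup>2 \<le> Re (cinner (D x) x)" for x
    proof -
      have "Re (cinner (A x) x) \<le> norm A * norm x * norm x"
        by (meson Re_cinner_le mult_right_mono norm_blinfun norm_ge_zero order_trans)
      then show ?thesis using False
        by (simp add: D \<sigma>_def cinner_simps cinner_self algebra_simps power2_eq_square del: of_real_power)
    qed
    then show ?thesis using that[of "t - norm A"] False \<open>t \<notin> _\<close> by simp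
  qed
  ultimately obtain B :: "'a \<Rightarrow>\<^sub>L 'a"
    where B: "B \<in> bounded_operators" "\<And>x. B (D x) = x" "\<And>x. D (B x) = x"
    using coercive_invertible by metis
  have "\<sigma> *\<^sub>R B \<in> bounded_operators"
    using B(1) by (simp add: bounded_operators_def blinfun.bilinear_simps scaleC_scaleR)
  moreover have "(\<sigma> *\<^sub>R B) (A x - complex_of_real t *\<^sub>C x) = x" for x
    using B(2)[of x] by (simp add: D scaleC_of_real blinfun.bilinear_simps scaleR_diff_right mult.commute)
  moreover have "A ((\<sigma> *\<^sub>R B) x) - complex_of_real t *\<^sub>C (\<sigma> *\<^sub>R B) x = x" for x
    using B(3)[of x] by (simp add: D scaleC_of_real blinfun.bilinear_simps scaleR_diff_right mult.commute)
  ultimately show False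
    using t unfolding real_spectrum_def op_spectrum_def by blast
qed

lemma polynomial_approximation:
  fixes f :: "real \<Rightarrow> real"
  assumes "continuous_on {a..b} f"
  obtains p where "uniform_limit {a..b} (\<lambda>n. poly (p n)) f sequentially"
proof -
  have "\<exists>p. \<forall>x\<in>{a..b}. \<bar>f x - poly p x\<bar> < inverse (real (Suc n))" for n
  proof -
    obtain g where g: "real_polynomial_function g"
      "\<And>x. x \<in> {a..b} \<Longrightarrow> \<bar>f x - g x\<bar> < inverse (real (Suc n))"
      using Stone_Weierstrass_real_polynomial_function[OF compact_Icc assms, of "inverse (real (Suc n))"]
      by auto
    obtain c m where "g = (\<lambda>x. \<Sum>i\<le>m. c i * x ^ i)"
      using g(1) real_polynomial_function_iff_sum by blast
    then have "g = poly (\<Sum>i\<le>m. monom (c i) i)" by (simp add: fun_eq_iff poly_sum poly_monom)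
    then show ?thesis using g(2) by metis
  qed
  then obtain p where p: "\<And>n x. x \<in> {a..b} \<Longrightarrow> \<bar>f x - poly (p n) x\<bar> < inverse (real (Suc n))"
    by metis
  have "uniform_limit {a..b} (\<lambda>n. poly (p n)) f sequentially"
  proof (rule uniform_limitI)
    fix e :: real assume "e > 0"
    then have "\<forall>\<^sub>F n in sequentially. inverse (real (Suc n)) < e"
      using LIMSEQ_inverse_real_of_nat order_tendstoD(2) by blast
    then show "\<forall>\<^sub>F n in sequentially. \<forall>x\<in>{a..b}. dist (poly (p n) x) (f x) < e"
    proof eventually_elim
      case (elim n)
      then show ?case using p[of _ n] by (force simp: dist_real_def abs_minus_commute)
    qed
  qed
  then show ?thesis using that by blast
qed

text \<open>Continuity is asked on a compact interval around the spectrum, where Weierstrass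
  approximation applies.\<close>

locale calculus =
  fixes A :: "'a::complex_hilbert \<Rightarrow>\<^sub>L 'a" and f :: "real \<Rightarrow> real" and a b :: real
  assumes selfadjoint: "selfadjoint_op A"
    and spectrum: "real_spectrum A \<subseteq> {a..b}"
    and continuous: "continuous_on {a..b} f"
begin

definition approx :: "(nat \<Rightarrow> real poly) \<Rightarrow> bool"
  where "approx p \<longleftrightarrow> uniform_limit (real_spectrum A) (\<lambda>n. poly (p n)) f sequentially"

lemma approx_exists: "\<exists>p. approx p"
  using polynomial_approximation[OF continuous] uniform_limit_on_subset[OF _ spectrum]
  unfolding approx_def by metis

text \<open>Two sequences are compared so that one estimate serves twice: with equal sequences it
  gives the Cauchy property, with different ones independence of the limit.\<close>

lemma approx_close:
  assumes p: "approx p" and q: "approx q" and e: "e > 0"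
  shows "\<exists>N. \<forall>m\<ge>N. \<forall>n\<ge>N. dist (op_poly (p m) A) (op_poly (q n) A) < e"
proof -
  have e4: "e / 4 > 0" using e by simp
  obtain N where N: "\<And>n t. n \<ge> N \<Longrightarrow> t \<in> real_spectrum A \<Longrightarrow> \<bar>poly (p n) t - f t\<bar> < e / 4"
    using uniform_limitD[OF p[unfolded approx_def] e4]
    by (auto simp: eventually_sequentially dist_real_def)
  obtain M where M: "\<And>n t. n \<ge> M \<Longrightarrow> t \<in> real_spectrum A \<Longrightarrow> \<bar>poly (q n) t - f t\<bar> < e / 4"
    using uniform_limitD[OF q[unfolded approx_def] e4]
    by (auto simp: eventually_sequentially dist_real_def)
  show ?thesis
  proof (intro exI[of _ "max N M"] allI impI)
    fix m n assume mn: "m \<ge> max N M" "n \<ge> max N M"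
    have "\<bar>poly (p m - q n) t\<bar> \<le> e / 2" if "t \<in> real_spectrum A" for t
    proof -
      have "\<bar>poly (p m) t - f t\<bar> < e / 4" "\<bar>poly (q n) t - f t\<bar> < e / 4"
        using N M mn that by auto
      then show ?thesis unfolding poly_diff by linarith
    qed
    then have "norm (op_poly (p m - q n) A) \<le> e / 2"
      using e by (intro norm_op_poly_le[OF selfadjoint]) auto
    then show "dist (op_poly (p m) A) (op_poly (q n) A) < e"
      using e by (simp add: dist_norm op_poly_diff)
  qed
qed

text \<open>All approximating sequences share one limit, and the given one rules out any other
  value, so the definite description denotes that limit.\<close>

lemma functional_calculus_limit:
  assumes "approx p"
  shows "(\<lambda>n. op_poly (p n) A) \<longlonglongrightarrow> functional_calculus f A"
proof -
  have "Cauchy (\<lambda>n. op_poly (p n) A)"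
    using approx_close[OF assms assms] by (rule metric_CauchyI)
  then obtain B where B: "(\<lambda>n. op_poly (p n) A) \<longlonglongrightarrow> B"
    using Cauchy_convergent convergentD by blast
  have limit: "(\<lambda>n. op_poly (q n) A) \<longlonglongrightarrow> B" if q: "approx q" for q
  proof -
    have "(\<lambda>n. op_poly (q n) A - op_poly (p n) A) \<longlonglongrightarrow> 0"
      unfolding tendsto_iff eventually_sequentially
      using approx_close[OF q assms] by (fastforce simp: dist_norm)
    then show ?thesis by (rule Lim_transform[OF B])
  qed
  have "functional_calculus f A = B"
    unfolding functional_calculus_def real_spectrum_def[symmetric] approx_def[symmetric]
  proof (rule the_equality)
    fix C assume "\<forall>p. approx p \<longrightarrow> (\<lambda>n. op_poly (p n) A) \<longlonglongrightarrow> C"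
    then show "C = B" using assms B LIMSEQ_unique by blast
  qed (use limit in blast)
  then show ?thesis using B by simp
qed

lemma functional_calculus_selfadjoint: "selfadjoint_op (functional_calculus f A)"
proof -
  let ?F = "functional_calculus f A"
  obtain p where "approx p" using approx_exists by blast
  then have lim: "(\<lambda>n. op_poly (p n) A) \<longlonglongrightarrow> ?F" by (rule functional_calculus_limit)
  then have limx: "(\<lambda>n. op_poly (p n) A x) \<longlonglongrightarrow> ?F x" for x
    by (rule blinfun.tendsto[OF _ tendsto_const])
  have P: "selfadjoint_op (op_poly (p n) A)" for n by (rule selfadjoint_op_poly[OF selfadjoint])
  have Re: "Re (cinner (?F x) y) = Re (cinner x (?F y))" for x y
  proof (rule LIMSEQ_unique)
    show "(\<lambda>n. Re (cinner (op_poly (p n) A x) y)) \<longlonglongrightarrow> Re (cinner (?F x) y)"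
      by (rule tendsto_Re_cinner[OF limx tendsto_const])
    show "(\<lambda>n. Re (cinner (op_poly (p n) A x) y)) \<longlonglongrightarrow> Re (cinner x (?F y))"
      unfolding selfadjoint_opD(3)[OF P] by (rule tendsto_Re_cinner[OF tendsto_const limx])
  qed
  \<comment> \<open>The scalar is moved onto the test vector, the limit is taken in real parts, and
    complex linearity of the polynomial operators brings it back inside.\<close>
  have scaleC: "?F (c *\<^sub>C x) = c *\<^sub>C ?F x" for c x
  proof (rule cinner_ext)
    fix y
    have "Re (cinner y (c *\<^sub>C ?F x)) = Re (cinner (cnj c *\<^sub>C y) (?F x))"
      by (simp add: cinner_simps)
    also have "\<dots> = Re (cinner y (?F (c *\<^sub>C x)))"
    proof (rule LIMSEQ_unique)
      show "(\<lambda>n. Re (cinner (cnj c *\<^sub>C y) (op_poly (p n) A x))) \<longlonglongrightarrow> Re (cinner (cnj c *\<^sub>C y) (?F x))"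
        by (rule tendsto_Re_cinner[OF tendsto_const limx])
      have "Re (cinner (cnj c *\<^sub>C y) (op_poly (p n) A x)) = Re (cinner y (op_poly (p n) A (c *\<^sub>C x)))" for n
        by (simp add: selfadjoint_opD(2)[OF P] cinner_simps)
      then show "(\<lambda>n. Re (cinner (cnj c *\<^sub>C y) (op_poly (p n) A x))) \<longlonglongrightarrow> Re (cinner y (?F (c *\<^sub>C x)))"
        using tendsto_Re_cinner[OF tendsto_const limx] by simp
    qed
    finally show "Re (cinner y (?F (c *\<^sub>C x))) = Re (cinner y (c *\<^sub>C ?F x))" by simp
  qed
  have "cinner (?F x) y = cinner x (?F y)" for x y
    by (rule complex_eqI[OF Re])
      (simp add: Im_cinner_eq scaleC[symmetric] Re)
  then show ?thesis using scaleC by (simp add: selfadjoint_op_def bounded_operators_def)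
qed

text \<open>Approximants of \<open>f\<close> raised by a small constant eventually dominate
  \<open>q\<close> on the spectrum, so positivity applies to the difference. Polynomial minorants
  serve for both positivity of square roots and McCarthy's inequality.\<close>

lemma op_poly_le_functional_calculus:
  assumes q: "\<And>t. t \<in> real_spectrum A \<Longrightarrow> poly q t \<le> f t"
  shows "Re (cinner (op_poly q A x) x) \<le> Re (cinner (functional_calculus f A x) x)"
proof (rule field_le_epsilon)
  fix e' :: real assume "e' > 0"
  \<comment> \<open>Chosen so that \<open>e * (norm x)\<^sup>2\<close> is at most \<open>e'\<close>;
    the \<open>+ 1\<close> covers \<open>x = 0\<close>.\<close>
  define e where "e = e' / ((norm x)\<^sup>2 + 1)"
  have e: "e > 0" unfolding e_def using \<open>e' > 0\<close> by (simp add: add_nonneg_pos)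
  have "e * (norm x)\<^sup>2 \<le> e * ((norm x)\<^sup>2 + 1)" using e by simp
  also have "\<dots> = e'" unfolding e_def
    by (simp add: add_nonneg_pos less_imp_neq[symmetric] add_nonneg_eq_0_iff)
  finally have ee': "e * (norm x)\<^sup>2 \<le> e'" .
  obtain p where p: "approx p" using approx_exists by blast
  have lim: "(\<lambda>n. Re (cinner (op_poly (p n) A x) x) + e * (norm x)\<^sup>2)
      \<longlonglongrightarrow> Re (cinner (functional_calculus f A x) x) + e * (norm x)\<^sup>2"
    by (intro tendsto_intros tendsto_Re_cinner blinfun.tendsto functional_calculus_limit p)
  have "\<forall>\<^sub>F n in sequentially. Re (cinner (op_poly q A x) x) \<le> Re (cinner (op_poly (p n) A x) x) + e * (norm x)\<^sup>2"
    using uniform_limitD[OF p[unfolded approx_def] e]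
  proof eventually_elim
    case (elim n)
    have "0 \<le> Re (cinner (op_poly (p n + [:e:] - q) A x) x)"
      by (rule op_poly_nonneg[OF selfadjoint])
        (use elim q in \<open>fastforce simp: dist_real_def abs_less_iff\<close>)
    then show ?case
      by (simp add: op_poly_diff op_poly_add op_poly_const_apply blinfun.bilinear_simps cinner_simps
          Re_cinner_self)
  qed
  then have "Re (cinner (op_poly q A x) x) \<le> Re (cinner (functional_calculus f A x) x) + e * (norm x)\<^sup>2"
    using tendsto_lowerbound[OF lim] by simp
  then show "Re (cinner (op_poly q A x) x) \<le> Re (cinner (functional_calculus f A x) x) + e'"
    using ee' by simp
qed

text \<open>Squares of approximants of \<open>f\<close> approximate \<open>q\<close>, and
  multiplication of polynomials is composition of operators. It identifies the square of a square
  root.\<close>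

lemma functional_calculus_square:
  assumes q: "\<And>t. t \<in> real_spectrum A \<Longrightarrow> f t * f t = poly q t"
  shows "functional_calculus f A (functional_calculus f A x) = op_poly q A x"
proof -
  interpret sq: calculus A "poly q" a b
    by unfold_locales (auto intro: selfadjoint spectrum[THEN subsetD] continuous_intros)
  obtain p where p: "approx p" using approx_exists by blast
  \<comment> \<open>Products of uniform limits converge uniformly only with a bound on the
    limit.\<close>
  have "bounded (f ` {a..b})"
    using continuous compact_continuous_image compact_imp_bounded compact_Icc by blast
  then have bdd: "bounded (f ` real_spectrum A)"
    using bounded_subset image_mono spectrum by metis
  have "uniform_limit (real_spectrum A) (\<lambda>n t. poly (p n) t * poly (p n) t) (\<lambda>t. f t * f t) sequentially"
    using p bdd unfolding approx_def by (intro uniform_lim_mult)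
  then have "sq.approx (\<lambda>n. p n * p n)"
    unfolding sq.approx_def
    by (rule uniform_limit_cong'[THEN iffD1, rotated -1]) (simp_all add: q)
  then have "(\<lambda>n. op_poly (p n * p n) A) \<longlonglongrightarrow> functional_calculus (poly q) A"
    by (rule sq.functional_calculus_limit)
  then have "(\<lambda>n. op_poly (p n * p n) A x) \<longlonglongrightarrow> functional_calculus (poly q) A x"
    by (rule blinfun.tendsto[OF _ tendsto_const])
  moreover have "(\<lambda>n. op_poly (p n * p n) A x) \<longlonglongrightarrow> functional_calculus f A (functional_calculus f A x)"
    unfolding op_poly_mult_apply
    by (intro blinfun.tendsto functional_calculus_limit p tendsto_const)
  \<comment> \<open>The constant sequence shows that the calculus returns \<open>op_poly q A\<close>
    for the polynomial function itself.\<close>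
  moreover have "sq.approx (\<lambda>n. q)"
    unfolding sq.approx_def by (simp add: uniform_limit_const)
  then have "(\<lambda>n. op_poly q A) \<longlonglongrightarrow> functional_calculus (poly q) A"
    by (rule sq.functional_calculus_limit)
  then have "op_poly q A = functional_calculus (poly q) A" by (simp add: LIMSEQ_const_iff)
  ultimately show ?thesis using LIMSEQ_unique by metis
qed

end

section \<open>Powers of the absolute value\<close>

lemma continuous_on_powr_const:
  "0 < c \<Longrightarrow> continuous_on {0..b} (\<lambda>t. t powr c)" for b c :: real
  by (rule continuous_on_powr'[OF continuous_on_id continuous_on_const]) auto

text \<open>Young's inequality for \<open>t powr r\<close> and \<open>s powr r\<close> with weights
  \<open>1/r\<close> and \<open>1 - 1/r\<close>, multiplied by \<open>r\<close>.\<close>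

lemma powr_above_tangent:
  fixes r s t :: real
  assumes "1 \<le> r" "0 \<le> s" "0 \<le> t"
  shows "s powr r + r * s powr (r - 1) * (t - s) \<le> t powr r"
proof (cases "s = 0")
  case False
  then have s: "s powr (r - 1) * s = s powr r"
    using \<open>0 \<le> s\<close> powr_mult_base[of s "r - 1"] by (simp add: mult.commute)
  have "r * (t * s powr (r - 1)) \<le> t powr r + (r * s powr r - s powr r)"
  proof (cases "t = 0")
    case False
    have "(t powr r) powr (1/r) * (s powr r) powr (1 - 1/r) \<le> 1/r * t powr r + (1 - 1/r) * s powr r"
      using assms False \<open>s \<noteq> 0\<close> by (intro Youngs_inequality_0) auto
    moreover have "(t powr r) powr (1/r) = t" "(s powr r) powr (1 - 1/r) = s powr (r - 1)"
      using assms False by (simp_all add: powr_powr right_diff_distrib)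
    ultimately have "r * (t * s powr (r - 1)) \<le> r * (1/r * t powr r + (1 - 1/r) * s powr r)"
      using assms by (intro mult_left_mono) auto
    also have "\<dots> = t powr r + (r * s powr r - s powr r)" using assms by (simp add: field_simps)
    finally show ?thesis .
  qed (use assms mult_right_mono[of 1 r "s powr r"] in simp)
  moreover have "r * s powr (r - 1) * (t - s) = r * (t * s powr (r - 1)) - r * s powr r"
    unfolding s[symmetric] by (simp add: algebra_simps)
  ultimately show ?thesis by linarith
\<comment> \<open>At \<open>s = 0\<close> the left side is 0, also for \<open>r = 1\<close>, since
  \<open>0 powr 0 = 0\<close>.\<close>
qed simp

text \<open>The tangent at the mean \<open>s\<close> lies below the power at \<open>a\<close> and at
  \<open>b\<close>; in the weighted sum the slope terms cancel.\<close>

lemma powr_convex_combination: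
  fixes \<alpha> r a b :: real
  assumes "1 \<le> r" "0 \<le> \<alpha>" "\<alpha> \<le> 1" "0 \<le> a" "0 \<le> b"
  shows "(\<alpha> * a + (1 - \<alpha>) * b) powr r \<le> \<alpha> * a powr r + (1 - \<alpha>) * b powr r"
proof -
  define s where "s = \<alpha> * a + (1 - \<alpha>) * b"
  define d where "d = r * s powr (r - 1)"
  have "0 \<le> s" using assms by (simp add: s_def)
  then have "\<alpha> * (s powr r + d * (a - s)) \<le> \<alpha> * a powr r"
    "(1 - \<alpha>) * (s powr r + d * (b - s)) \<le> (1 - \<alpha>) * b powr r"
    using assms powr_above_tangent[of r s] by (auto simp: d_def intro!: mult_left_mono)
  moreover have "\<alpha> * (s powr r + d * (a - s)) + (1 - \<alpha>) * (s powr r + d * (b - s)) = s powr r"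
  proof -
    have "\<alpha> * (s powr r + d * (a - s)) + (1 - \<alpha>) * (s powr r + d * (b - s))
        = s powr r + d * (\<alpha> * a + (1 - \<alpha>) * b - s)"
      by (simp add: algebra_simps)
    then show ?thesis by (simp add: s_def)
  qed
  ultimately show ?thesis unfolding s_def by linarith
qed

lemma powr_add_le:
  fixes r a b :: real
  assumes "1 \<le> r" "0 \<le> a" "0 \<le> b"
  shows "(a + b) powr r \<le> 2 powr (r - 1) * (a powr r + b powr r)"
proof -
  have "(a + b) powr r = 2 powr r * ((1/2) * a + (1 - 1/2) * b) powr r"
    using assms by (subst powr_mult[symmetric]) (simp_all add: algebra_simps)
  also have "\<dots> \<le> 2 powr r * ((1/2) * a powr r + (1 - 1/2) * b powr r)"
    using assms by (intro mult_left_mono powr_convex_combination) auto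
  also have "\<dots> = 2 powr (r - 1) * (a powr r + b powr r)"
    by (simp add: powr_diff field_simps)
  finally show ?thesis .
qed

section \<open>Absolute values of operators and McCarthy's inequality\<close>

lemma bounded_operators_compose:
  "S \<in> bounded_operators \<Longrightarrow> T \<in> bounded_operators \<Longrightarrow> S o\<^sub>L T \<in> bounded_operators"
  by (simp add: bounded_operators_def)

text \<open>The square of \<open>op_abs T\<close> is \<open>cadjoint T o\<^sub>L T\<close>, whose
  quadratic form is the squared norm of \<open>T x\<close>. Positivity comes from the zero
  polynomial as a minorant of the square root.\<close>

lemma
  assumes T: "T \<in> bounded_operators"
  shows selfadjoint_op_abs: "selfadjoint_op (op_abs T)"
    and op_abs_nonneg: "0 \<le> Re (cinner (op_abs T x) x)"
    and norm_op_abs: "norm (op_abs T x) = norm (T x)"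
proof -
  define P where "P = cadjoint T o\<^sub>L T"
  have P: "cinner (P x) y = cinner (T x) (T y)" "cinner x (P y) = cinner (T x) (T y)" for x y
  proof -
    show *: "cinner x (P y) = cinner (T x) (T y)" for x y
      by (simp add: P_def cinner_cadjoint[OF T])
    show "cinner (P x) y = cinner (T x) (T y)"
      by (metis * cinner_commute)
  qed
  have "P \<in> bounded_operators"
    unfolding P_def by (intro bounded_operators_compose cadjoint_in T)
  then have P_sa: "selfadjoint_op P" by (simp add: selfadjoint_op_def P)
  have spectrum: "real_spectrum P \<subseteq> {0..norm P}"
    by (rule real_spectrum_nonneg[OF P_sa]) (simp add: P Re_cinner_self)
  interpret calculus P "\<lambda>t. t powr (1/2)" 0 "norm P"
    using P_sa spectrum continuous_on_powr_const by unfold_locales auto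
  have abs: "op_abs T = functional_calculus (\<lambda>t. t powr (1/2)) P"
    by (simp add: op_abs_def op_powr_def P_def)
  show sa: "selfadjoint_op (op_abs T)"
    unfolding abs by (rule functional_calculus_selfadjoint)
  show "0 \<le> Re (cinner (op_abs T x) x)"
    unfolding abs using op_poly_le_functional_calculus[of 0 x] by simp
  have "op_abs T (op_abs T x) = op_poly [:0, 1:] P x"
    unfolding abs
    by (rule functional_calculus_square) (use spectrum in \<open>auto simp: powr_half_sqrt subset_iff\<close>)
  also have "\<dots> = P x" by (simp add: op_poly_pCons_apply blinfun.bilinear_simps)
  finally have "(norm (op_abs T x))\<^sup>2 = Re (cinner x (P x))"
    using selfadjoint_opD(3)[OF sa, of x "op_abs T x"] by (simp add: Re_cinner_self[symmetric])
  then show "norm (op_abs T x) = norm (T x)" by (simp add: P Re_cinner_self)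
qed

text \<open>McCarthy's inequality: compare \<open>t powr (2 * r)\<close> with the tangent of \<open>u powr r\<close> at \<open>\<parallel>T x\<parallel>\<^sup>2\<close>,
  evaluated at \<open>u = t\<^sup>2\<close>; this is a polynomial in \<open>t\<close>, so no composition rule for the functional
  calculus is needed.\<close>

lemma norm_powr_le_op_powr_abs:
  assumes T: "T \<in> bounded_operators" and r: "1 \<le> r" and x: "norm x = 1"
  shows "norm (T x) powr (2 * r) \<le> Re (cinner (op_powr (op_abs T) (2 * r) x) x)"
proof -
  define B where "B = op_abs T"
  have B: "selfadjoint_op B" unfolding B_def by (rule selfadjoint_op_abs[OF T])
  have spectrum: "real_spectrum B \<subseteq> {0..norm B}"
    unfolding B_def
    by (rule real_spectrum_nonneg[OF selfadjoint_op_abs[OF T] op_abs_nonneg[OF T]])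
  interpret calculus B "\<lambda>t. t powr (2 * r)" 0 "norm B"
    using B spectrum r continuous_on_powr_const by unfold_locales auto
  define s where "s = (norm (T x))\<^sup>2"
  define d where "d = r * s powr (r - 1)"
  define q where "q = [:s powr r - d * s, 0, d:]"
  have two: "u powr (2 * r) = (u\<^sup>2) powr r" if "0 \<le> u" for u :: real
    using that powr_powr[of u 2 r] by simp
  \<comment> \<open>Together with \<open>norm x = 1\<close> this cancels the slope terms of
    \<open>q\<close>, leaving \<open>s powr r\<close> as its quadratic form.\<close>
  have "Re (cinner (B (B x)) x) = s"
    using selfadjoint_opD(3)[OF B, of "B x" x] norm_op_abs[OF T, of x]
    by (simp add: Re_cinner_self s_def B_def)
  then have "s powr r = Re (cinner (op_poly q B x) x)"
    using x by (simp add: q_def op_poly_pCons_apply blinfun.bilinear_simps cinner_simps cinner_self)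
  also have "\<dots> \<le> Re (cinner (functional_calculus (\<lambda>t. t powr (2 * r)) B x) x)"
  proof (rule op_poly_le_functional_calculus)
    fix t assume "t \<in> real_spectrum B"
    then have "0 \<le> t" using spectrum by auto
    then show "poly q t \<le> t powr (2 * r)"
      using powr_above_tangent[OF r, of s "t\<^sup>2"] unfolding two[OF \<open>0 \<le> t\<close>]
      by (simp add: q_def d_def s_def algebra_simps power2_eq_square)
  qed
  finally show ?thesis by (simp add: s_def two op_powr_def B_def)
qed

section \<open>The bound at a unit vector and passage to the supremum\<close>

lemma davis_wielandt_pointwise:
  fixes S :: "'a::complex_hilbert \<Rightarrow>\<^sub>L 'a" and \<alpha> r :: real
  assumes S: "S \<in> bounded_operators" and \<alpha>: "0 \<le> \<alpha>" "\<alpha> \<le> 1" and r: "1 \<le> r" and x: "norm x = 1"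
  shows "((cmod (cinner (S x) x))\<^sup>2 + norm (S x) ^ 4) powr r \<le> 2 powr (r - 1) *
    norm (\<alpha> *\<^sub>R op_powr (op_abs S) (2 * r)
        + (1 - \<alpha>) *\<^sub>R op_powr (op_abs (cadjoint S)) (2 * r)
        + op_powr (op_abs (cadjoint S o\<^sub>L S)) (2 * r))"
    (is "_ \<le> _ * norm ?M")
proof -
  note adj = cadjoint_in[OF S]
  define g where "g = (cmod (cinner (S x) x))\<^sup>2"
  define a where "a = (norm (S x))\<^sup>2"
  define b where "b = (norm (cadjoint S x))\<^sup>2"
  define k where "k = norm (S x) ^ 4"
  have nonneg: "0 \<le> g" "0 \<le> a" "0 \<le> b" "0 \<le> k" by (simp_all add: g_def a_def b_def k_def)
  have two: "u powr (2 * r) = (u\<^sup>2) powr r" if "0 \<le> u" for u :: real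
    using that powr_powr[of u 2 r] by simp
  have ga: "g \<le> a"
    using cmod_cinner_le[of "S x" x] x by (simp add: g_def a_def power_mono)
  have gb: "g \<le> b"
    using cmod_cinner_le[of x "cadjoint S x"] x
    by (simp add: g_def b_def power_mono cinner_cadjoint[OF S])
  have "g = \<alpha> * g + (1 - \<alpha>) * g" by (simp add: algebra_simps)
  also have "\<dots> \<le> \<alpha> * a + (1 - \<alpha>) * b"
    using \<alpha> ga gb by (intro add_mono mult_left_mono) auto
  finally have "g powr r \<le> (\<alpha> * a + (1 - \<alpha>) * b) powr r"
    using nonneg r by (intro powr_mono2) auto
  also have "\<dots> \<le> \<alpha> * a powr r + (1 - \<alpha>) * b powr r"
    using \<alpha> r nonneg by (intro powr_convex_combination) auto
  also have "\<dots> \<le> \<alpha> * Re (cinner (op_powr (op_abs S) (2 * r) x) x)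
      + (1 - \<alpha>) * Re (cinner (op_powr (op_abs (cadjoint S)) (2 * r) x) x)"
    using \<alpha> norm_powr_le_op_powr_abs[OF S r x] norm_powr_le_op_powr_abs[OF adj r x]
    by (intro add_mono mult_left_mono) (auto simp: two a_def b_def)
  finally have g: "g powr r \<le> \<dots>" .
  \<comment> \<open>As \<open>k\<close> is the square of \<open>(norm (S x))\<^sup>2\<close>, its
    power \<open>r\<close> is the power \<open>2 * r\<close> of that number, which matches
    McCarthy's inequality for \<open>cadjoint S o\<^sub>L S\<close>.\<close>
  have "(norm (S x))\<^sup>2 = Re (cinner x ((cadjoint S o\<^sub>L S) x))"
    by (simp add: cinner_cadjoint[OF S, symmetric] Re_cinner_self)
  also have "\<dots> \<le> norm ((cadjoint S o\<^sub>L S) x)"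
    using Re_cinner_le[of x "(cadjoint S o\<^sub>L S) x"] x by simp
  finally have "((norm (S x))\<^sup>2) powr (2 * r) \<le> norm ((cadjoint S o\<^sub>L S) x) powr (2 * r)"
    using r by (intro powr_mono2) auto
  also have "\<dots> \<le> Re (cinner (op_powr (op_abs (cadjoint S o\<^sub>L S)) (2 * r) x) x)"
    by (rule norm_powr_le_op_powr_abs[OF bounded_operators_compose[OF adj S] r x])
  finally have k: "k powr r \<le> \<dots>" by (simp add: k_def two)
  have "(g + k) powr r \<le> 2 powr (r - 1) * (g powr r + k powr r)"
    using r nonneg by (intro powr_add_le) auto
  also have "g powr r + k powr r \<le> Re (cinner (?M x) x)"
    using g k by (simp add: blinfun.bilinear_simps cinner_simps)
  also have "\<dots> \<le> norm ?M"
    using Re_cinner_le[of "?M x" x] norm_blinfun[of ?M x] x by simp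
  finally show ?thesis by (simp add: g_def k_def)
qed

theorem theorem6:
  fixes S :: "'a::complex_hilbert \<Rightarrow>\<^sub>L 'a" and \<alpha> r :: real
  assumes "S \<in> bounded_operators"
    and "0 \<le> \<alpha>" and "\<alpha> \<le> 1"
    and "1 \<le> r"
  shows "dw S powr (2 * r) \<le> 2 powr (r - 1) *
    norm (\<alpha> *\<^sub>R op_powr (op_abs S) (2 * r)
        + (1 - \<alpha>) *\<^sub>R op_powr (op_abs (cadjoint S)) (2 * r)
        + op_powr (op_abs (cadjoint S o\<^sub>L S)) (2 * r))"
    (is "_ \<le> ?R")
proof (cases "(UNIV :: 'a set) = {0}")
  case True
  then show ?thesis by (simp add: dw_def)
next
  case False
  let ?h = "\<lambda>x. sqrt ((cmod (cinner (S x) x))\<^sup>2 + norm (S x) ^ 4)"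
  \<comment> \<open>Taking the root of order \<open>2 * r\<close> gives a bound independent of
    \<open>x\<close>, which can pass to the supremum.\<close>
  have h: "?h x \<le> ?R powr (1 / (2 * r))" if "norm x = 1" for x
  proof -
    let ?w = "(cmod (cinner (S x) x))\<^sup>2 + norm (S x) ^ 4"
    have "?h x = (?w powr r) powr (1 / (2 * r))"
      using assms by (simp add: powr_powr powr_half_sqrt)
    also have "\<dots> \<le> ?R powr (1 / (2 * r))"
      using assms that by (intro powr_mono2 davis_wielandt_pointwise) auto
    finally show ?thesis .
  qed
  obtain y :: 'a where "y \<noteq> 0" using False by blast
  then have y: "norm ((1 / norm y) *\<^sub>R y) = 1" by simp
  have "dw S \<le> ?R powr (1 / (2 * r))"
    unfolding dw_def using False y h by (simp, intro cSUP_least) (blast, simp)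
  \<comment> \<open>Raising to the power \<open>2 * r\<close> is monotone on nonnegative numbers;
    the supremum lies above a value at some unit vector, and \<open>h\<close> provides
    boundedness.\<close>
  moreover have "0 \<le> dw S"
  proof -
    have "?h ((1 / norm y) *\<^sub>R y) \<le> dw S"
      unfolding dw_def using False y h
      by (auto intro!: cSUP_upper bdd_aboveI2)
    then show ?thesis by (smt (verit) real_sqrt_ge_zero zero_le_power2 zero_le_power norm_ge_zero)
  qed
  ultimately have "dw S powr (2 * r) \<le> (?R powr (1 / (2 * r))) powr (2 * r)"
    using assms by (intro powr_mono2) auto
  also have "\<dots> = ?R" using assms by (simp add: powr_powr)
  finally show ?thesis .
qed

end
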